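(* Let $G$ and $H$ be graphs each of order at least $2$. Then $\gamma_{mt}^{2}(G+H)=2$.
   Context: All graphs are finite, simple and undirected. The join $G+H$ is the graph with vertex set $V(G)\cup V(H)$ (disjoint union) whose edges are those of $G$, those of $H$, and all edges $uv$ with $u\in V(G)$, $v\in V(H)$. A set $S \subseteq V(X)$ is a total dominating set of a graph $X$ if every vertex of $V(X)$ is adjacent to some vertex of $S$. A non-empty $T\subseteq V(X)$ is a 2-movable total dominating set of a connected graph $X$ if $T$ is a total dominating set and for every pair $x,y\in T$, either $T\setminus\{x,y\}$ is a total dominating set of $X$, or there exist $u,v\in V(X)\setminus T$ such that $u$ is adjacent to $x$, $v$ is adjacent to $y$, and $(T\setminus\{x,y\})\cup\{u,v\}$ is a total dominating set of $X$. $\gamma_{mt}^2(X)$ is the minimum cardinality of a 2-movable total dominating set of $X$. *)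

theory Defs
  imports "Graph_Theory.Graph_Theory"
begin

text \<open>
  Finite simple undirected graphs are the instances of the locale \<^locale>\<open>pair_graph\<close>: an edge
  \<open>uv\<close> is represented by the two arcs \<open>(u, v)\<close> and \<open>(v, u)\<close>. The disjoint union of the two vertex
  sets in a join is formed in the sum type.
\<close>

definition graph_join ::
  "'a pair_pre_digraph \<Rightarrow> 'b pair_pre_digraph \<Rightarrow> ('a + 'b) pair_pre_digraph" where
  "graph_join G H = \<lparr>
     pverts = pverts G <+> pverts H,
     parcs = {(Inl u, Inl v) | u v. (u, v) \<in> parcs G}
           \<union> {(Inr u, Inr v) | u v. (u, v) \<in> parcs H}
           \<union> {(Inl u, Inr v) | u v. u \<in> pverts G \<and> v \<in> pverts H}
           \<union> {(Inr v, Inl u) | u v. u \<in> pverts G \<and> v \<in> pverts H} \<rparr>"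

lemma pair_graph_graph_join:
  assumes "pair_graph G" and "pair_graph H"
  shows "pair_graph (graph_join G H)"
proof -
  interpret G: pair_graph G by fact
  interpret H: pair_graph H by fact
  have wf: "pair_wf_digraph (graph_join G H)"
    by unfold_locales (auto simp: graph_join_def dest: G.wellformed' H.wellformed')
  then interpret wf: pair_wf_digraph "graph_join G H" .
  have fin: "finite (pverts (graph_join G H))"
    by (simp add: graph_join_def G.pair_finite_verts H.pair_finite_verts)
  have "parcs (graph_join G H) \<subseteq> pverts (graph_join G H) \<times> pverts (graph_join G H)"
    by (auto dest: wf.wellformed')
  with fin have "finite (parcs (graph_join G H))"
    by (meson finite_SigmaI finite_subset)
  with fin show ?thesis
    by unfold_locales
      (auto simp: graph_join_def symmetric_def sym_def
        dest: G.arcs_symmetric H.arcs_symmetric G.no_loops' H.no_loops')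
qed

definition total_dominating_set :: "'a pair_pre_digraph \<Rightarrow> 'a set \<Rightarrow> bool" where
  "total_dominating_set X S \<longleftrightarrow>
     S \<subseteq> pverts X \<and> (\<forall>v \<in> pverts X. \<exists>s \<in> S. (v, s) \<in> parcs X)"

text \<open>
  A pair consists of two distinct vertices. The replacement vertices \<open>u\<close> and \<open>v\<close> are not required
  to be distinct.
\<close>

definition two_movable_total_dominating_set :: "'a pair_pre_digraph \<Rightarrow> 'a set \<Rightarrow> bool" where
  "two_movable_total_dominating_set X T \<longleftrightarrow>
     connected (with_proj X) \<and> T \<noteq> {} \<and> total_dominating_set X T \<and>
     (\<forall>x \<in> T. \<forall>y \<in> T. x \<noteq> y \<longrightarrow>
        total_dominating_set X (T - {x, y}) \<or>
        (\<exists>u \<in> pverts X - T. \<exists>v \<in> pverts X - T.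
           (u, x) \<in> parcs X \<and> (v, y) \<in> parcs X \<and>
           total_dominating_set X ((T - {x, y}) \<union> {u, v})))"

text \<open>
  On natural numbers the infimum of a non-empty set is its minimum, and the infimum of the empty
  set is \<open>0\<close>. As all sets considered are non-empty and, in a finite graph, finite, a positive value
  is attained, and the value \<open>0\<close> means that there is no such set.
\<close>

definition two_movable_total_domination_number :: "'a pair_pre_digraph \<Rightarrow> nat" where
  "two_movable_total_domination_number X =
     Inf {card T | T. two_movable_total_dominating_set X T}"

end

theory Submission
  imports Defs
begin

text \<open>Any pair \<open>{Inl a, Inr b}\<close> with one vertex on each side totally dominates
  the join: \<open>b\<close> is adjacent to all of \<open>G\<close>, and \<open>a\<close> to all of
  \<open>H\<close> (\<open>total_dominating_set_graph_join_cross_pair\<close>). With a second vertex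
  on each side, such a pair can be moved to the disjoint pair \<open>{Inl a', Inr b'}\<close>, again
  dominating, so 2 is attained. Fewer vertices never suffice, since a member of a total dominating
  set needs a neighbour in the set other than itself
  (\<open>card_total_dominating_set_ge_2\<close>).\<close>

lemma Inl_in_pverts_graph_join [simp]: "Inl u \<in> pverts (graph_join G H) \<longleftrightarrow> u \<in> pverts G"
  and Inr_in_pverts_graph_join [simp]: "Inr v \<in> pverts (graph_join G H) \<longleftrightarrow> v \<in> pverts H"
  by (auto simp: graph_join_def)

lemma Inl_Inr_in_parcs_graph_join [simp]:
    "(Inl u, Inr v) \<in> parcs (graph_join G H) \<longleftrightarrow> u \<in> pverts G \<and> v \<in> pverts H"
  and Inr_Inl_in_parcs_graph_join [simp]:
    "(Inr v, Inl u) \<in> parcs (graph_join G H) \<longleftrightarrow> u \<in> pverts G \<and> v \<in> pverts H"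
  by (auto simp: graph_join_def)

text \<open>\<open>connected\<close> is strong connectedness of the symmetric closure, and closing
  under reversal only adds arcs, so existing walks survive.\<close>

lemma (in wf_digraph) strongly_connected_imp_connected:
  assumes "strongly_connected G"
  shows "connected G"
  using assms by (auto simp: connected_def strongly_connected_def intro: reachable_mk_symmetricI)

text \<open>Vertices on opposite sides are adjacent; two on the same side are linked through any
  vertex of the other side.\<close>

lemma strongly_connected_graph_join:
  assumes "pair_graph G" and "pair_graph H" and "pverts G \<noteq> {}" and "pverts H \<noteq> {}"
  shows "strongly_connected (with_proj (graph_join G H))"
proof -
  interpret J: pair_graph "graph_join G H"
    using assms(1,2) by (rule pair_graph_graph_join)
  \<comment> \<open>These serve as intermediate stops: \<open>b\<close> between two vertices of
    \<open>G\<close>, \<open>a\<close> between two vertices of \<open>H\<close>.\<close>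
  obtain a b where ab: "a \<in> pverts G" "b \<in> pverts H" using assms(3,4) by blast
  have cross: "Inl u \<rightarrow>\<^sup>*\<^bsub>with_proj (graph_join G H)\<^esub> Inr v"
    "Inr v \<rightarrow>\<^sup>*\<^bsub>with_proj (graph_join G H)\<^esub> Inl u"
    if "u \<in> pverts G" "v \<in> pverts H" for u v
    using that by (auto intro!: J.reachable_adjI simp: arcs_ends_def)
  have "x \<rightarrow>\<^sup>*\<^bsub>with_proj (graph_join G H)\<^esub> y"
    if "x \<in> pverts (graph_join G H)" "y \<in> pverts (graph_join G H)" for x y
    using that ab
    by (cases x; cases y) (auto intro: cross J.reachable_trans)
  with assms(3) show ?thesis
    by (intro strongly_connectedI) (auto simp: graph_join_def)
qed

lemma total_dominating_set_graph_join_cross_pair: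
  assumes "a \<in> pverts G" and "b \<in> pverts H"
  shows "total_dominating_set (graph_join G H) {Inl a, Inr b}"
  unfolding total_dominating_set_def
proof (intro conjI ballI)
  fix x assume "x \<in> pverts (graph_join G H)"
  with assms show "\<exists>s \<in> {Inl a, Inr b}. (x, s) \<in> parcs (graph_join G H)"
    by (cases x) auto
qed (use assms in simp)

text \<open>A member of \<open>S\<close> must itself be dominated from within \<open>S\<close>, and
  without loops its dominator is a second member.\<close>

lemma (in pair_graph) card_total_dominating_set_ge_2:
  assumes "total_dominating_set G S" and "S \<noteq> {}"
  shows "card S \<ge> 2"
proof -
  obtain x where x: "x \<in> S" using assms(2) by blast
  then obtain y where y: "y \<in> S" "(x, y) \<in> parcs G"
    using assms(1) unfolding total_dominating_set_def by blast
  then have "x \<noteq> y" using no_loops' by blast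
  then have "card {x, y} = 2" by simp
  moreover have "finite S"
    using assms(1) pair_finite_verts finite_subset unfolding total_dominating_set_def by blast
  ultimately show ?thesis
    using card_mono[of S "{x, y}"] x y by simp
qed

theorem theorem3p3:
  fixes G :: "'a pair_pre_digraph" and H :: "'b pair_pre_digraph"
  assumes "pair_graph G" and "pair_graph H"
    and "card (pverts G) \<ge> 2" and "card (pverts H) \<ge> 2"
  shows "two_movable_total_domination_number (graph_join G H) = 2"
proof -
  interpret J: pair_graph "graph_join G H"
    using assms(1,2) by (rule pair_graph_graph_join)
  \<comment> \<open>The order bounds give each side a spare vertex: \<open>a\<close> and
    \<open>b\<close> form the set, \<open>a'\<close> and \<open>b'\<close> are where it
    moves.\<close>
  obtain a a' where a: "a \<in> pverts G" "a' \<in> pverts G" "a \<noteq> a'"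
    using assms(3) by (meson card_2_iff' obtain_subset_with_card_n subsetD)
  obtain b b' where b: "b \<in> pverts H" "b' \<in> pverts H" "b \<noteq> b'"
    using assms(4) by (meson card_2_iff' obtain_subset_with_card_n subsetD)
  let ?T = "{Inl a, Inr b} :: ('a + 'b) set"
  have "connected (with_proj (graph_join G H))"
    using strongly_connected_graph_join[OF assms(1,2)] a b
      J.strongly_connected_imp_connected by blast
  moreover have dom: "total_dominating_set (graph_join G H) ?T"
    and dom': "total_dominating_set (graph_join G H) {Inl a', Inr b'}"
    using a b by (simp_all add: total_dominating_set_graph_join_cross_pair)
  \<comment> \<open>The move crosses over: \<open>a\<close> is replaced by its neighbour \<open>b'\<close> and \<open>b\<close> by its neighbour \<open>a'\<close>.\<close>
  moreover have "\<exists>u \<in> pverts (graph_join G H) - ?T. \<exists>v \<in> pverts (graph_join G H) - ?T.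
      (u, x) \<in> parcs (graph_join G H) \<and> (v, y) \<in> parcs (graph_join G H) \<and>
      total_dominating_set (graph_join G H) ((?T - {x, y}) \<union> {u, v})"
    if "x \<in> ?T" "y \<in> ?T" "x \<noteq> y" for x y
  proof -
    \<comment> \<open>Pairs are quantified in both orders. Either way \<open>?T - {x, y}\<close> is
      empty, so the moved set is exactly the cross pair of \<open>dom'\<close>.\<close>
    from that consider "x = Inl a" "y = Inr b" | "x = Inr b" "y = Inl a" by blast
    then show ?thesis
    proof cases
      case 1
      with a b dom' show ?thesis
        by (intro bexI[of _ "Inr b'"] bexI[of _ "Inl a'"]) (auto simp: insert_commute)
    next
      case 2
      with a b dom' show ?thesis
        by (intro bexI[of _ "Inl a'"] bexI[of _ "Inr b'"]) (auto simp: insert_commute)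
    qed
  qed
  ultimately have "two_movable_total_dominating_set (graph_join G H) ?T"
    unfolding two_movable_total_dominating_set_def by blast
  moreover have "card ?T = 2" by simp
  ultimately have "2 \<in> {card T | T. two_movable_total_dominating_set (graph_join G H) T}"
    by (metis (mono_tags, lifting) mem_Collect_eq)
  \<comment> \<open>Membership of 2 rules out the default infimum 0 of the empty set; the conjunct
    \<open>T \<noteq> {}\<close> of the definition feeds the lower bound.\<close>
  then show ?thesis
    unfolding two_movable_total_domination_number_def
    by (intro cInf_eq_minimum)
      (auto simp: two_movable_total_dominating_set_def intro: J.card_total_dominating_set_ge_2)
qed

end
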